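(* Let $x=(x^+;x^-;\xi)$ be any feasible point of problem (MPCC). Then the Guignard constraint qualification holds at $x$.
   Context: Let $A\in\mathbb{R}^{m\times n}$, $b\in\mathbb{R}^m$, $\gamma>0$, and $f=f_Q+g:\mathbb{R}^n\to\mathbb{R}$ where $f_Q$ is a quadratic function and $g$ is a smooth convex function; $e$ is the all-ones vector. Problem (MPCC): $\min_{x^+,x^-,\xi\in\mathbb{R}^n} f(x^+-x^-)+\gamma e^T(e-\xi)$ subject to $A(x^+-x^-)\ge b$, $(x^++x^-)^T\xi=0$ (a single scalar equality constraint), $x^+\ge 0$, $x^-\ge 0$, $0\le\xi_i\le1$ for $i=1,\dots,n$. For a set $\Omega=\{x\in\mathbb{R}^N: G(x)\le 0,\ H(x)=0\}$ with continuously differentiable $G:\mathbb{R}^N\to\mathbb{R}^p$, $H:\mathbb{R}^N\to\mathbb{R}^q$, and $x^*\in\Omega$ with active set $\mathcal{I}(x^* )=\{i:G_i(x^* )=0\}$, the tangent cone is $$T_\Omega(x^* )=\Big\{d:\exists \{x_k\}\subseteq\Omega,\ \{t_k\}\downarrow0 \text{ with } x_k\to x^*,\ d=\lim_{k\to\infty}\tfrac{x_k-x^*}{t_k}\Big\},$$ and the linearized cone is $$L_\Omega(x^* )=\{d:\nabla G_i(x^* )^Td\le0\ \forall i\in\mathcal{I}(x^* ),\ \nabla H_j(x^* )^Td=0,\ j=1,\dots,q\}.$$ For a cone $C$, $C^*=\{v: d^Tv\le0\ \forall d\in C\}$. The Guignard constraint qualification holds at $x^*$ iff $(T_\Omega(x^*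 ))^*=(L_\Omega(x^* ))^*$. For (MPCC), $\Omega$ is its feasible set with the constraints written exactly as listed above. *)

theory Defs
  imports "HOL-Analysis.Analysis"
begin

definition grad :: "('a::euclidean_space \<Rightarrow> real) \<Rightarrow> 'a \<Rightarrow> 'a" where
  "grad f x = (THE D. GDERIV f x :> D)"

definition C1_fun :: "('a::euclidean_space \<Rightarrow> real) \<Rightarrow> bool" where
  "C1_fun f \<longleftrightarrow> (\<exists>f'. (\<forall>x. GDERIV f x :> f' x) \<and> continuous_on UNIV f')"

lemma grad_eqI:
  assumes "GDERIV f x :> D"
  shows "grad f x = D"
proof -
  have "E = D" if "GDERIV f x :> E" for E
  proof -
    have eq: "(\<lambda>h. h \<bullet> E) = (\<lambda>h. h \<bullet> D)"
      using that assms unfolding gderiv_def by (rule has_derivative_unique)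
    have "\<forall>h. h \<bullet> E = h \<bullet> D"
      using fun_cong[OF eq] by simp
    then show ?thesis
      by (simp only: vector_eq_ldot)
  qed
  with assms show ?thesis
    unfolding grad_def by (intro the_equality)
qed

definition quadratic_fun :: "(real^'n \<Rightarrow> real) \<Rightarrow> bool" where
  "quadratic_fun q \<longleftrightarrow>
     (\<exists>Q c r. transpose Q = Q \<and> (\<forall>x. q x = (1/2) * (x \<bullet> (Q *v x)) + c \<bullet> x + r))"

text \<open>Minimise \<open>objective P\<close> subject to \<open>ineq_con P i x \<le> 0\<close> for all \<open>i\<close> and
  \<open>eq_con P j x = 0\<close> for all \<open>j\<close>.  The cones below are meant for continuously differentiable
  \<open>ineq_con P i\<close> and \<open>eq_con P j\<close>; the linearized cone and the Guignard condition depend on this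
  description of the feasible set, not only on the set itself.\<close>

record ('a, 'p, 'q) nlp =
  objective :: "'a \<Rightarrow> real"
  ineq_con :: "'p \<Rightarrow> 'a \<Rightarrow> real"
  eq_con :: "'q \<Rightarrow> 'a \<Rightarrow> real"

definition feasible_set :: "('a::euclidean_space, 'p::finite, 'q::finite) nlp \<Rightarrow> 'a set" where
  "feasible_set P = {x. (\<forall>i. ineq_con P i x \<le> 0) \<and> (\<forall>j. eq_con P j x = 0)}"

definition tangent_cone :: "'a::euclidean_space set \<Rightarrow> 'a \<Rightarrow> 'a set" where
  "tangent_cone S x = {d. \<exists>(X :: nat \<Rightarrow> 'a) (t :: nat \<Rightarrow> real).
     (\<forall>k. X k \<in> S) \<and> (\<forall>k. 0 < t k) \<and> decseq t \<and> t \<longlonglongrightarrow> 0 \<and> X \<longlonglongrightarrow> x \<and>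
     (\<lambda>k. (X k - x) /\<^sub>R t k) \<longlonglongrightarrow> d}"

definition active_set ::
  "('a::euclidean_space, 'p::finite, 'q::finite) nlp \<Rightarrow> 'a \<Rightarrow> 'p set" where
  "active_set P x = {i. ineq_con P i x = 0}"

definition linearized_cone ::
  "('a::euclidean_space, 'p::finite, 'q::finite) nlp \<Rightarrow> 'a \<Rightarrow> 'a set" where
  "linearized_cone P x = {d. (\<forall>i \<in> active_set P x. grad (ineq_con P i) x \<bullet> d \<le> 0) \<and>
                             (\<forall>j. grad (eq_con P j) x \<bullet> d = 0)}"

definition polar_cone :: "'a::euclidean_space set \<Rightarrow> 'a set" where
  "polar_cone C = {v. \<forall>d \<in> C. d \<bullet> v \<le> 0}"

definition guignard_cq ::
  "('a::euclidean_space, 'p::finite, 'q::finite) nlp \<Rightarrow> 'a \<Rightarrow> bool" where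
  "guignard_cq P x \<longleftrightarrow>
     polar_cone (tangent_cone (feasible_set P) x) = polar_cone (linearized_cone P x)"

datatype ('m, 'n) mpcc_ineq_index =
  Lin 'm | Pos_nonneg 'n | Neg_nonneg 'n | Xi_lower 'n | Xi_upper 'n

instance mpcc_ineq_index :: (finite, finite) finite
proof
  have "(UNIV :: ('a, 'b) mpcc_ineq_index set) =
    range Lin \<union> range Pos_nonneg \<union> range Neg_nonneg \<union> range Xi_lower \<union> range Xi_upper"
    (is "_ = ?R")
  proof (intro set_eqI iffI UNIV_I)
    fix x :: "('a, 'b) mpcc_ineq_index"
    show "x \<in> ?R" by (cases x) auto
  qed
  moreover have "finite \<dots>"
    by (intro finite_UnI finite_imageI finite_class.finite_UNIV)
  ultimately show "finite (UNIV :: ('a, 'b) mpcc_ineq_index set)"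
    by (rule ssubst)
qed

type_synonym 'n mpcc_point = "(real^'n) \<times> (real^'n) \<times> (real^'n)"

fun mpcc_ineq ::
  "real^'n^'m \<Rightarrow> real^'m \<Rightarrow> ('m, 'n) mpcc_ineq_index \<Rightarrow> 'n mpcc_point \<Rightarrow> real" where
  "mpcc_ineq A b (Lin i) (xp, xm, \<xi>) = b $ i - (A *v (xp - xm)) $ i"
| "mpcc_ineq A b (Pos_nonneg j) (xp, xm, \<xi>) = - (xp $ j)"
| "mpcc_ineq A b (Neg_nonneg j) (xp, xm, \<xi>) = - (xm $ j)"
| "mpcc_ineq A b (Xi_lower j) (xp, xm, \<xi>) = - (\<xi> $ j)"
| "mpcc_ineq A b (Xi_upper j) (xp, xm, \<xi>) = \<xi> $ j - 1"

text \<open>The vector \<open>1 :: real^'n\<close> is the all-ones vector.  The index type \<open>unit\<close> of the equality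
  constraints reflects that complementarity is imposed as one scalar equation.\<close>

definition mpcc ::
  "(real^'n \<Rightarrow> real) \<Rightarrow> real \<Rightarrow> real^'n^'m \<Rightarrow> real^'m \<Rightarrow>
     ('n mpcc_point, ('m, 'n) mpcc_ineq_index, unit) nlp" where
  "mpcc f \<gamma> A b =
     \<lparr>objective = (\<lambda>(xp, xm, \<xi>). f (xp - xm) + \<gamma> * (1 \<bullet> (1 - \<xi>))),
      ineq_con = mpcc_ineq A b,
      eq_con = (\<lambda>_ (xp, xm, \<xi>). (xp + xm) \<bullet> \<xi>)\<rparr>"

lemma feasible_mpcc_iff:
  fixes A :: "real^'b^'c"
  shows "(xp, xm, \<xi>) \<in> feasible_set (mpcc f \<gamma> A b) \<longleftrightarrow>
     (\<forall>i. (A *v (xp - xm)) $ i \<ge> b $ i) \<and> (xp + xm) \<bullet> \<xi> = 0 \<and>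
     (\<forall>j. 0 \<le> xp $ j) \<and> (\<forall>j. 0 \<le> xm $ j) \<and> (\<forall>j. 0 \<le> \<xi> $ j \<and> \<xi> $ j \<le> 1)"
proof -
  have "(\<forall>i. Q i) \<longleftrightarrow> (\<forall>k. Q (Lin k)) \<and> (\<forall>k. Q (Pos_nonneg k)) \<and> (\<forall>k. Q (Neg_nonneg k)) \<and>
      (\<forall>k. Q (Xi_lower k)) \<and> (\<forall>k. Q (Xi_upper k))" for Q :: "('c, 'b) mpcc_ineq_index \<Rightarrow> bool"
    by (metis mpcc_ineq_index.exhaust)
  from this[of "\<lambda>i. mpcc_ineq A b i (xp, xm, \<xi>) \<le> 0"] show ?thesis
    unfolding feasible_set_def mpcc_def by simp blast
qed

lemma C1_fun_affine:
  fixes l :: "'a::euclidean_space \<Rightarrow> real"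
  assumes "linear l"
  shows "C1_fun (\<lambda>x. l x + c)"
proof -
  have l: "l = (\<lambda>h. h \<bullet> adjoint l 1)"
    using adjoint_works[OF assms, of _ 1] by (intro ext) simp
  have "((\<lambda>x. l x + c) has_derivative l) (at x)" for x
    using has_derivative_add[OF linear_imp_has_derivative[OF assms] has_derivative_const] by simp
  then have "GDERIV (\<lambda>x. l x + c) x :> adjoint l 1" for x
    unfolding gderiv_def by (subst (asm) (2) l)
  then show ?thesis
    unfolding C1_fun_def by (intro exI[of _ "\<lambda>_. adjoint l 1"]) auto
qed

lemma C1_fun_mpcc_ineq:
  fixes A :: "real^'b^'c"
  shows "C1_fun (ineq_con (mpcc f \<gamma> A b) i)"
proof -
  have "\<exists>l c. linear l \<and> mpcc_ineq A b i = (\<lambda>x. l x + c)"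
  proof (cases i)
    case (Lin k)
    have "linear (\<lambda>z :: 'b mpcc_point. - ((A *v fst z) $ k) + (A *v fst (snd z)) $ k)"
      by (rule linearI)
        (simp_all add: matrix_vector_right_distrib matrix_vector_mult_scaleR right_diff_distrib)
    moreover have "mpcc_ineq A b i =
        (\<lambda>z. - ((A *v fst z) $ k) + (A *v fst (snd z)) $ k + b $ k)"
      by (auto simp: Lin matrix_vector_mult_diff_distrib)
    ultimately show ?thesis by blast
  next
    case (Pos_nonneg k)
    show ?thesis
      by (rule exI[of _ "\<lambda>(xp, xm, \<xi>). - (xp $ k)"], rule exI[of _ 0])
        (auto simp: Pos_nonneg linear_iff)
  next
    case (Neg_nonneg k)
    show ?thesis
      by (rule exI[of _ "\<lambda>(xp, xm, \<xi>). - (xm $ k)"], rule exI[of _ 0])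
        (auto simp: Neg_nonneg linear_iff)
  next
    case (Xi_lower k)
    show ?thesis
      by (rule exI[of _ "\<lambda>(xp, xm, \<xi>). - (\<xi> $ k)"], rule exI[of _ 0])
        (auto simp: Xi_lower linear_iff)
  next
    case (Xi_upper k)
    show ?thesis
      by (rule exI[of _ "\<lambda>(xp, xm, \<xi>). \<xi> $ k"], rule exI[of _ "-1"])
        (auto simp: Xi_upper linear_iff)
  qed
  then show ?thesis
    by (auto simp: mpcc_def C1_fun_affine)
qed

lemma C1_fun_mpcc_eq:
  fixes A :: "real^'b^'c"
  shows "C1_fun (eq_con (mpcc f \<gamma> A b) j)"
proof -
  have *: "eq_con (mpcc f \<gamma> A b) j = (\<lambda>z. (fst z + fst (snd z)) \<bullet> snd (snd z))"
    by (auto simp: mpcc_def)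
  have "GDERIV (eq_con (mpcc f \<gamma> A b) j) x :>
      (snd (snd x), snd (snd x), fst x + fst (snd x))" for x
  proof -
    have "((\<lambda>z. (fst z + fst (snd z)) \<bullet> snd (snd z)) has_derivative
        (\<lambda>h. (fst x + fst (snd x)) \<bullet> snd (snd h) + (fst h + fst (snd h)) \<bullet> snd (snd x))) (at x)"
      by (intro has_derivative_inner has_derivative_add has_derivative_fst has_derivative_snd
          has_derivative_ident)
    also have "(\<lambda>h. (fst x + fst (snd x)) \<bullet> snd (snd h) + (fst h + fst (snd h)) \<bullet> snd (snd x)) =
        (\<lambda>h. h \<bullet> (snd (snd x), snd (snd x), fst x + fst (snd x)))"
      by (intro ext) (simp add: inner_prod_def inner_add_left inner_add_right inner_commute)
    finally show ?thesis unfolding * gderiv_def .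
  qed
  moreover have "continuous_on UNIV
      (\<lambda>x :: 'b mpcc_point. (snd (snd x), snd (snd x), fst x + fst (snd x)))"
    by (intro continuous_intros)
  ultimately show ?thesis
    unfolding C1_fun_def by (intro exI[of _ "\<lambda>x. (snd (snd x), snd (snd x), fst x + fst (snd x))"]) simp
qed

end

theory Submission
  imports Defs
begin

text \<open>The tangent cone always lies in the linearized cone, so the content is that a vector making
  an obtuse or right angle with every tangent direction does so with every linearized direction
  \<open>d = (dp, dm, d\<xi>)\<close>. It suffices to write \<open>d\<close> as a sum of tangent directions, and
  \<open>d = (dp, dm, 0) + (0, 0, d\<xi>)\<close> does it.

  The linearized complementarity equation says
  \<open>(dp + dm) \<bullet> \<xi> + (xp + xm) \<bullet> d\<xi> = 0\<close>. Both summands are nonnegative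
  (\<open>mpcc_linearized_terms_nonneg\<close>): where \<open>\<xi>\<close> is positive, complementarity
  makes both sign constraints on \<open>xp\<close> and \<open>xm\<close> active, and where \<open>xp + xm\<close> is positive, it
  makes the lower bound on \<open>\<xi>\<close> active. Hence both summands vanish. Moving from the given point
  along either part of \<open>d\<close> keeps one factor of the bilinear form
  \<open>(xp + xm) \<bullet> \<xi>\<close> fixed, so the form changes only by a multiple of one
  of these summands and stays zero. All inequality constraints are affine, and each of them
  involves only \<open>(xp, xm)\<close> or only \<open>\<xi>\<close>, so that splitting \<open>d\<close> does not
  destroy the linearized inequalities. Both parts are therefore directions along which the point
  stays feasible for a short time (\<open>mpcc_tangent_direction\<close>).

  The directions themselves need not be tangent: at an index with \<open>xp = xm = \<xi> = 0\<close> the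
  vector \<open>d\<close> may increase both factors. This is why, in general, only
  the polars of the two cones agree.\<close>

section \<open>Tangent and linearized directions\<close>

text \<open>A tangent direction is a limit of difference quotients of points that need not lie on a ray.
  The first-order expansion of \<open>G\<close> shows that the difference quotients of \<open>G\<close> converge
  nevertheless: the remainder is a null sequence times the norm of a convergent one.\<close>

lemma gderiv_tendsto_along_tangent:
  fixes G :: "'a::euclidean_space \<Rightarrow> real"
  assumes D: "GDERIV G x :> D"
    and t: "\<And>k. 0 < t k" and X: "X \<longlonglongrightarrow> x"
    and q: "(\<lambda>k. (X k - x) /\<^sub>R t k) \<longlonglongrightarrow> d"
  shows "(\<lambda>k. (G (X k) - G x) / t k) \<longlonglongrightarrow> D \<bullet> d"
proof -
  \<comment> \<open>The relative remainder of the first-order expansion; division by zero gives it the value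
    0 at \<open>x\<close>, which makes it continuous there.\<close>
  define E where "E y = (G y - G x - (y - x) \<bullet> D) / norm (y - x)" for y
  have "(E \<longlongrightarrow> E x) (at x)"
    using D tendsto_norm_zero_iff[of E "at x"]
    by (simp add: gderiv_def has_derivative_iff_norm E_def)
  then have "(\<lambda>k. E (X k)) \<longlonglongrightarrow> E x"
    by (intro isCont_tendsto_compose[OF _ X]) (simp add: isCont_def)
  then have "(\<lambda>k. ((X k - x) /\<^sub>R t k) \<bullet> D + norm ((X k - x) /\<^sub>R t k) * E (X k))
      \<longlonglongrightarrow> d \<bullet> D + norm d * E x"
    by (intro tendsto_intros q)
  moreover have "(G (X k) - G x) / t k =
      ((X k - x) /\<^sub>R t k) \<bullet> D + norm ((X k - x) /\<^sub>R t k) * E (X k)" for k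
  proof -
    have "norm (X k - x) * E (X k) = G (X k) - G x - (X k - x) \<bullet> D"
      by (simp add: E_def)
    moreover have "((X k - x) /\<^sub>R t k) \<bullet> D + norm ((X k - x) /\<^sub>R t k) * E (X k) =
        ((X k - x) \<bullet> D + norm (X k - x) * E (X k)) / t k"
      using t[of k] by (simp only: inner_scaleR_left norm_scaleR) (simp add: divide_simps)
    ultimately show ?thesis by simp
  qed
  ultimately show ?thesis
    by (simp add: E_def inner_commute)
qed

text \<open>Along a sequence of feasible points, an active inequality constraint has nonpositive difference
  quotients and an equality constraint has vanishing ones; both properties pass to the limit.\<close>

theorem tangent_cone_subset_linearized_cone:
  fixes P :: "('a::euclidean_space, 'p::finite, 'q::finite) nlp"
  assumes ineq: "\<And>i. C1_fun (ineq_con P i)" and eq: "\<And>j. C1_fun (eq_con P j)"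
    and x: "x \<in> feasible_set P"
  shows "tangent_cone (feasible_set P) x \<subseteq> linearized_cone P x"
proof
  fix d assume "d \<in> tangent_cone (feasible_set P) x"
  then obtain X t where X: "\<And>k. X k \<in> feasible_set P" and t: "\<And>k::nat. 0 < t k"
    and Xx: "X \<longlonglongrightarrow> x" and q: "(\<lambda>k. (X k - x) /\<^sub>R t k) \<longlonglongrightarrow> d"
    unfolding tangent_cone_def by auto
  have lim: "(\<lambda>k. (G (X k) - G x) / t k) \<longlonglongrightarrow> grad G x \<bullet> d" if "C1_fun G" for G
    using that gderiv_tendsto_along_tangent[OF _ t Xx q] grad_eqI unfolding C1_fun_def by metis
  have "grad (ineq_con P i) x \<bullet> d \<le> 0" if "i \<in> active_set P x" for i
    using that X t
    by (intro LIMSEQ_le_const2[OF lim[OF ineq]])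
      (auto simp: active_set_def feasible_set_def divide_le_0_iff less_imp_le)
  moreover have "grad (eq_con P j) x \<bullet> d = 0" for j
  proof -
    have "(\<lambda>k. (eq_con P j (X k) - eq_con P j x) / t k) = (\<lambda>k. 0)"
      using X x by (auto simp: feasible_set_def)
    with lim[OF eq[of j]] show ?thesis
      by (simp add: LIMSEQ_const_iff)
  qed
  ultimately show "d \<in> linearized_cone P x"
    unfolding linearized_cone_def by blast
qed

lemma feasible_direction_in_tangent_cone:
  fixes x d :: "'a::euclidean_space"
  assumes "\<forall>\<^sub>F s in at_right 0. x + s *\<^sub>R d \<in> S"
  shows "d \<in> tangent_cone S x"
proof -
  obtain \<epsilon> :: real where \<epsilon>: "\<epsilon> > 0" and S: "\<And>s. 0 < s \<Longrightarrow> s < \<epsilon> \<Longrightarrow> x + s *\<^sub>R d \<in> S"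
    using assms unfolding eventually_at_right_field by blast
  define t where "t k = \<epsilon> / real (k + 2)" for k
  have t_pos: "0 < t k" and t_less: "t k < \<epsilon>" for k
    using \<epsilon> by (auto simp: t_def field_simps add_pos_nonneg)
  have t_dec: "decseq t"
    using \<epsilon> by (auto simp: decseq_def t_def intro!: divide_left_mono)
  have t_lim: "t \<longlonglongrightarrow> 0"
    unfolding t_def by (rule LIMSEQ_ignore_initial_segment[OF lim_const_over_n])
  have X_lim: "(\<lambda>k. x + t k *\<^sub>R d) \<longlonglongrightarrow> x"
    using tendsto_add[OF tendsto_const tendsto_scaleR[OF t_lim tendsto_const], of x d] by simp
  have "(\<lambda>k. ((x + t k *\<^sub>R d) - x) /\<^sub>R t k) = (\<lambda>k. d)"
    using t_pos by (auto simp: less_imp_neq[symmetric])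
  then have "(\<lambda>k. ((x + t k *\<^sub>R d) - x) /\<^sub>R t k) \<longlonglongrightarrow> d"
    by simp
  with t_pos t_less t_dec t_lim X_lim S show ?thesis
    unfolding tangent_cone_def
    by (intro CollectI exI[of _ "\<lambda>k. x + t k *\<^sub>R d"] exI[of _ t]) simp
qed

text \<open>With this the linearized constraints can be read off from one-variable polynomials:
  only the products of the gradients with directions matter, not the gradients themselves.\<close>

lemma grad_inner_eq_directional_derivative:
  fixes G :: "'a::euclidean_space \<Rightarrow> real"
  assumes "C1_fun G" and dir: "((\<lambda>s. G (x + s *\<^sub>R d)) has_real_derivative c) (at 0)"
  shows "grad G x \<bullet> d = c"
proof -
  obtain D where D: "GDERIV G x :> D"
    using assms(1) unfolding C1_fun_def by blast
  have "((\<lambda>s. x + s *\<^sub>R d) has_derivative (\<lambda>s. s *\<^sub>R d)) (at 0)"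
    by (auto intro!: derivative_eq_intros)
  then have "((\<lambda>s. G (x + s *\<^sub>R d)) has_derivative (\<lambda>s. (s *\<^sub>R d) \<bullet> D)) (at 0)"
    by (rule has_derivative_compose) (use D in \<open>simp add: gderiv_def\<close>)
  then have "((\<lambda>s. G (x + s *\<^sub>R d)) has_real_derivative d \<bullet> D) (at 0)"
    by (simp add: has_field_derivative_def mult.commute[of _ "d \<bullet> D"])
  from DERIV_unique[OF this dir] show ?thesis
    using grad_eqI[OF D] by (simp add: inner_commute)
qed

text \<open>A feasible affine constraint survives a short step: an inactive one by continuity, an active
  one by the sign of its slope.\<close>

lemma eventually_affine_le_0:
  fixes a c :: real
  assumes "a \<le> 0" and "a = 0 \<Longrightarrow> c \<le> 0"
  shows "\<forall>\<^sub>F s in at_right 0. a + s * c \<le> 0"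
proof (cases "a = 0")
  case True
  with assms show ?thesis
    by (auto intro!: eventually_mono[OF eventually_at_right_less] mult_nonneg_nonpos)
next
  case False
  have "((\<lambda>s. a + s * c) \<longlongrightarrow> a + 0 * c) (at_right 0)"
    by (intro tendsto_intros)
  with False assms(1) have "\<forall>\<^sub>F s in at_right 0. a + s * c < 0"
    by (intro order_tendstoD(2)) auto
  then show ?thesis
    by (rule eventually_mono) simp
qed

section \<open>The complementarity problem\<close>

fun mpcc_ineq_slope ::
  "real^'n^'m \<Rightarrow> ('m, 'n) mpcc_ineq_index \<Rightarrow> 'n mpcc_point \<Rightarrow> real" where
  "mpcc_ineq_slope A (Lin i) (dp, dm, d\<xi>) = - (A *v (dp - dm)) $ i"
| "mpcc_ineq_slope A (Pos_nonneg j) (dp, dm, d\<xi>) = - (dp $ j)"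
| "mpcc_ineq_slope A (Neg_nonneg j) (dp, dm, d\<xi>) = - (dm $ j)"
| "mpcc_ineq_slope A (Xi_lower j) (dp, dm, d\<xi>) = - (d\<xi> $ j)"
| "mpcc_ineq_slope A (Xi_upper j) (dp, dm, d\<xi>) = d\<xi> $ j"

lemma mpcc_ineq_affine:
  "mpcc_ineq A b i (z + s *\<^sub>R d) = mpcc_ineq A b i z + s * mpcc_ineq_slope A i d"
  by (cases z; cases d; cases i)
    (simp_all add: algebra_simps matrix_vector_mult_diff_distrib
      matrix_vector_right_distrib matrix_vector_mult_scaleR)

lemma complementarity_form_along_ray:
  fixes xp :: "'a::real_inner"
  shows "((xp + s *\<^sub>R dp) + (xm + s *\<^sub>R dm)) \<bullet> (\<xi> + s *\<^sub>R d\<xi>) =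
    (xp + xm) \<bullet> \<xi> + s * ((dp + dm) \<bullet> \<xi> + (xp + xm) \<bullet> d\<xi>) + s\<^sup>2 * ((dp + dm) \<bullet> d\<xi>)"
  by (simp add: inner_add_left inner_add_right algebra_simps power2_eq_square)

lemma mpcc_linearized_cone_iff:
  fixes A :: "real^'n^'m"
  shows "(dp, dm, d\<xi>) \<in> linearized_cone (mpcc f \<gamma> A b) (xp, xm, \<xi>) \<longleftrightarrow>
    (\<forall>i. mpcc_ineq A b i (xp, xm, \<xi>) = 0 \<longrightarrow> mpcc_ineq_slope A i (dp, dm, d\<xi>) \<le> 0) \<and>
    (dp + dm) \<bullet> \<xi> + (xp + xm) \<bullet> d\<xi> = 0"
proof -
  have "grad (ineq_con (mpcc f \<gamma> A b) i) z \<bullet> d = mpcc_ineq_slope A i d" for i z d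
    by (rule grad_inner_eq_directional_derivative[OF C1_fun_mpcc_ineq])
      (auto simp: mpcc_def mpcc_ineq_affine intro!: derivative_eq_intros)
  moreover have "grad (eq_con (mpcc f \<gamma> A b) j) (xp, xm, \<xi>) \<bullet> (dp, dm, d\<xi>) =
      (dp + dm) \<bullet> \<xi> + (xp + xm) \<bullet> d\<xi>" for j
    by (rule grad_inner_eq_directional_derivative[OF C1_fun_mpcc_eq])
      (simp only: mpcc_def nlp.simps scaleR_Pair add_Pair prod.case complementarity_form_along_ray,
       auto intro!: derivative_eq_intros)
  ultimately show ?thesis
    by (simp add: linearized_cone_def active_set_def) (simp add: mpcc_def)
qed

text \<open>The single scalar equation is a vanishing sum of nonnegative products, so each product
  vanishes.\<close>

lemma mpcc_complementarity_componentwise: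
  fixes A :: "real^'n^'m"
  assumes "(xp, xm, \<xi>) \<in> feasible_set (mpcc f \<gamma> A b)"
  shows "\<xi> $ j = 0 \<or> xp $ j = 0 \<and> xm $ j = 0"
proof -
  have nn: "0 \<le> xp $ k" "0 \<le> xm $ k" "0 \<le> \<xi> $ k" for k
    using assms by (auto simp: feasible_mpcc_iff)
  have "(\<Sum>k\<in>UNIV. (xp $ k + xm $ k) * \<xi> $ k) = 0"
    using assms by (simp add: feasible_mpcc_iff inner_vec_def)
  then have "(xp $ j + xm $ j) * \<xi> $ j = 0"
    using nn by (subst (asm) sum_nonneg_eq_0_iff) auto
  then show ?thesis
    using nn[of j] by (auto simp: add_nonneg_eq_0_iff)
qed

text \<open>A componentwise argument: where \<open>\<xi>\<close> is positive, \<open>xp\<close> and \<open>xm\<close> vanish, so that the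
  active sign constraints force \<open>dp\<close> and \<open>dm\<close> to be nonnegative, and symmetrically where
  \<open>xp + xm\<close> is positive.\<close>

lemma mpcc_linearized_terms_nonneg:
  fixes A :: "real^'n^'m"
  assumes x: "(xp, xm, \<xi>) \<in> feasible_set (mpcc f \<gamma> A b)"
    and d: "(dp, dm, d\<xi>) \<in> linearized_cone (mpcc f \<gamma> A b) (xp, xm, \<xi>)"
  shows "0 \<le> (dp + dm) \<bullet> \<xi>" and "0 \<le> (xp + xm) \<bullet> d\<xi>"
proof -
  have nn: "0 \<le> xp $ j" "0 \<le> xm $ j" "0 \<le> \<xi> $ j" for j
    using x by (auto simp: feasible_mpcc_iff)
  have slope: "mpcc_ineq_slope A i (dp, dm, d\<xi>) \<le> 0" if "mpcc_ineq A b i (xp, xm, \<xi>) = 0" for i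
    using d that by (simp add: mpcc_linearized_cone_iff)
  note compl = mpcc_complementarity_componentwise[OF x]
  have "0 \<le> (dp $ j + dm $ j) * \<xi> $ j" for j
    using compl[of j] nn[of j] slope[of "Pos_nonneg j"] slope[of "Neg_nonneg j"] by auto
  then show "0 \<le> (dp + dm) \<bullet> \<xi>"
    by (simp add: inner_vec_def sum_nonneg)
  have "0 \<le> (xp $ j + xm $ j) * d\<xi> $ j" for j
    using compl[of j] nn[of j] slope[of "Xi_lower j"] by auto
  then show "0 \<le> (xp + xm) \<bullet> d\<xi>"
    by (simp add: inner_vec_def sum_nonneg)
qed

text \<open>The complementarity form is quadratic along the ray, with the linearized equation as its linear
  coefficient. Its second-order coefficient \<open>(dp + dm) \<bullet> d\<xi>\<close> is the
  obstruction to moving straight along a linearized direction.\<close>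

lemma mpcc_tangent_direction:
  fixes A :: "real^'n^'m"
  assumes x: "(xp, xm, \<xi>) \<in> feasible_set (mpcc f \<gamma> A b)"
    and d: "(dp, dm, d\<xi>) \<in> linearized_cone (mpcc f \<gamma> A b) (xp, xm, \<xi>)"
    and bil: "(dp + dm) \<bullet> d\<xi> = 0"
  shows "(dp, dm, d\<xi>) \<in> tangent_cone (feasible_set (mpcc f \<gamma> A b)) (xp, xm, \<xi>)"
proof (rule feasible_direction_in_tangent_cone)
  have le: "mpcc_ineq A b i (xp, xm, \<xi>) \<le> 0" for i
    using x by (simp add: feasible_set_def mpcc_def)
  have x_eq: "(xp + xm) \<bullet> \<xi> = 0"
    using x by (simp add: feasible_mpcc_iff)
  have slope: "mpcc_ineq_slope A i (dp, dm, d\<xi>) \<le> 0" if "mpcc_ineq A b i (xp, xm, \<xi>) = 0" for i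
    using d that by (simp add: mpcc_linearized_cone_iff)
  have d_eq: "(dp + dm) \<bullet> \<xi> + (xp + xm) \<bullet> d\<xi> = 0"
    using d by (simp add: mpcc_linearized_cone_iff)
  have eq: "((xp + s *\<^sub>R dp) + (xm + s *\<^sub>R dm)) \<bullet> (\<xi> + s *\<^sub>R d\<xi>) = 0" for s
    by (simp add: complementarity_form_along_ray x_eq d_eq bil)
  have "\<forall>\<^sub>F s in at_right 0.
      \<forall>i. mpcc_ineq A b i ((xp, xm, \<xi>) + s *\<^sub>R (dp, dm, d\<xi>)) \<le> 0"
    unfolding mpcc_ineq_affine
    by (intro eventually_all_finite eventually_affine_le_0 le slope)
  then show "\<forall>\<^sub>F s in at_right 0.
      (xp, xm, \<xi>) + s *\<^sub>R (dp, dm, d\<xi>) \<in> feasible_set (mpcc f \<gamma> A b)"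
    by (rule eventually_mono) (use eq in \<open>simp add: feasible_set_def mpcc_def\<close>)
qed

text \<open>The two terms of the linearized complementarity equation are nonnegative and sum to zero, so
  each part satisfies this equation on its own. The inequality constraints split because each of
  them sees only one of the two parts.\<close>

lemma mpcc_linearized_split:
  fixes A :: "real^'n^'m"
  assumes x: "(xp, xm, \<xi>) \<in> feasible_set (mpcc f \<gamma> A b)"
    and d: "(dp, dm, d\<xi>) \<in> linearized_cone (mpcc f \<gamma> A b) (xp, xm, \<xi>)"
  shows "(dp, dm, 0) \<in> linearized_cone (mpcc f \<gamma> A b) (xp, xm, \<xi>)"
    and "(0, 0, d\<xi>) \<in> linearized_cone (mpcc f \<gamma> A b) (xp, xm, \<xi>)"
proof -
  have slope: "mpcc_ineq_slope A i (dp, dm, d\<xi>) \<le> 0" if "mpcc_ineq A b i (xp, xm, \<xi>) = 0" for i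
    using d that by (simp add: mpcc_linearized_cone_iff)
  have sum0: "(dp + dm) \<bullet> \<xi> + (xp + xm) \<bullet> d\<xi> = 0"
    using d by (simp add: mpcc_linearized_cone_iff)
  have terms: "(dp + dm) \<bullet> \<xi> = 0" "(xp + xm) \<bullet> d\<xi> = 0"
    using sum0 mpcc_linearized_terms_nonneg[OF x d] by linarith+
  have "mpcc_ineq_slope A i (dp, dm, 0) \<le> 0 \<and> mpcc_ineq_slope A i (0, 0, d\<xi>) \<le> 0"
    if "mpcc_ineq A b i (xp, xm, \<xi>) = 0" for i
    using slope[OF that] by (cases i) simp_all
  with terms show "(dp, dm, 0) \<in> linearized_cone (mpcc f \<gamma> A b) (xp, xm, \<xi>)"
    and "(0, 0, d\<xi>) \<in> linearized_cone (mpcc f \<gamma> A b) (xp, xm, \<xi>)"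
    by (simp_all add: mpcc_linearized_cone_iff)
qed

theorem lemma2:
  fixes A :: "real^'n^'m" and b :: "real^'m" and \<gamma> :: real
    and f f\<^sub>Q g :: "real^'n \<Rightarrow> real"
    and x :: "'n mpcc_point"
  assumes "\<gamma> > 0"
    and "quadratic_fun f\<^sub>Q"
    and "C1_fun g" and "convex_on UNIV g"
    and "f = (\<lambda>y. f\<^sub>Q y + g y)"
    and "x \<in> feasible_set (mpcc f \<gamma> A b)"
  shows "guignard_cq (mpcc f \<gamma> A b) x"
proof -
  let ?T = "tangent_cone (feasible_set (mpcc f \<gamma> A b)) x"
  let ?L = "linearized_cone (mpcc f \<gamma> A b) x"
  obtain xp xm \<xi> where x: "x = (xp, xm, \<xi>)"
    by (cases x)
  note feas = assms(6)[unfolded x]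
  have "?T \<subseteq> ?L"
    by (rule tangent_cone_subset_linearized_cone[OF C1_fun_mpcc_ineq C1_fun_mpcc_eq assms(6)])
  then have "polar_cone ?L \<subseteq> polar_cone ?T"
    unfolding polar_cone_def by blast
  moreover have "polar_cone ?T \<subseteq> polar_cone ?L"
  proof
    fix v assume v: "v \<in> polar_cone ?T"
    have "d \<bullet> v \<le> 0" if "d \<in> ?L" for d
    proof -
      obtain dp dm d\<xi> where d: "d = (dp, dm, d\<xi>)"
        by (cases d)
      note split = mpcc_linearized_split[OF feas that[unfolded x d]]
      have "(dp, dm, 0) \<bullet> v \<le> 0" "(0, 0, d\<xi>) \<bullet> v \<le> 0"
        using v mpcc_tangent_direction[OF feas split(1)] mpcc_tangent_direction[OF feas split(2)]
        unfolding polar_cone_def x by auto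
      moreover have "d = (dp, dm, 0) + (0, 0, d\<xi>)"
        by (simp add: d)
      ultimately show ?thesis
        by (simp only: inner_add_left)
    qed
    then show "v \<in> polar_cone ?L"
      unfolding polar_cone_def by blast
  qed
  ultimately show ?thesis
    unfolding guignard_cq_def by blast
qed

end
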